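(* Let $m,n\ge1$, let $T$ be a semistandard tableau for $\mathfrak{sl}(m,n)$ and let $(S^+,S^-)$ be a trivial extractable pair in $T$. Let $R=T\setminus(S^+\uplus S^-)$, and let $R_0=R,\ R_1=sjdt_{d_1}(R_0),\ \dots,\ R_k=sjdt_{d_k}(R_{k-1})$ be the sequence of skew tableaux obtained by successively applying the super jeu de taquin, where $d_{r}$ is the greatest element of $Out(R_{r-1})$ and $k$ is such that $Out(R_k)$ is empty. Then $R_k$ is a semistandard tableau. If $(S^+,S^-)$ is the maximal trivial extractable pair in $T$ (so that $R_k=:maxjdt(R)$), then $R_k=push(T)$; that is, $push=maxjdt$.
   Context: **Shapes and tableaux.** A shape is a pair $\lambda=(a,a')=((a_1,\dots,a_m),(a'_1,\dots,a'_{n-1}))$ of sequences of nonnegative integers with $a_m\ge\sup\{j: a'_j>0\}$ (with $\sup\emptyset=0$). Put $A_i=a_i+\dots+a_m$ and $A'_j=a'_j+\dots+a'_{n-1}$. The Ferrer diagram of shape $\lambda$ consists of the boxes $(i,j)$ (row $i$, counted from the top, column $j$) with $1\le i\le m$, $1\le j\le A_i$, and the boxes $(m+i,j)$ with $1\le j\le n-1$, $1\le i\le A'_j$. A tableau $T=(t_{i,j})$ of shape $\lambda$ is a filling of the boxes by elements of $\{1,\dots,m+n\}$; $T^+$ denotes its first $m$ rows, $T^-$ the part consisting of the rows with index $>m$, and one writes $T=T^+\uplus T^-$. $T$ is semistandard if (whenever both members exist) $t_{i,j}\le t_{i,j+1}$, with strict inequality if $t_{i,j}>m$, and $t_{i,j}\le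 t_{i+1,j}$, with strict inequality if $t_{i,j}\le m$. **Trivial extractable pairs and push.** A trivial tableau $S^+$ is a (possibly empty) left-justified array of boxes in rows $1,\dots,m$, with row lengths $B_1\ge\dots\ge B_m\ge0$, with entry $i$ in every box $(i,j)$. A trivial tableau $S^-$ is a (possibly empty) top-justified array of boxes in rows $>m$ with column heights $B'_1\ge\dots\ge B'_{n-1}\ge0$ (boxes $(m+i,j)$, $1\le i\le B'_j$), with entry $m+j$ in every box $(m+i,j)$. The pair $(S^+,S^-)$ is extractable from a semistandard tableau $T$ if $S^+$ (resp. $S^-$) is the top-left subtableau (same boxes, same entries) of $T^+$ (resp. $T^-$) and the filling $U$ given by $u_{i,j}=t_{i,j+B_i}$ ($i\le m$), $u_{i,j}=t_{i+B'_j,j}$ ($i>m$) is a semistandard tableau (in particular its diagram is the Ferrer diagram of a shape). Among the trivial pairs extractable from $T$ there is a unique largest (maximal) one for componentwise inclusion; $push(T)$ is the tableau $U$ obtained for this largest pair. **Skew tableaux and outer corners.** $T\setminus(S^+\uplus S^-)$ is the skew tableau obtained from $T$ by emptying the boxes of $S^+$ and $S^-$; these emptied boxes form the inner diagram, with upper part $F_\mu^+$ (boxes of $S^+$) and lower part $F_\mu^-$ (boxes of $S^-$). A skew tableau with entries $t_{i,j}$ is semistandard if, whenever both members exist, $t_{i,j}\le t_{i,j+1}$, with strict inequality if $t_{i,j}>m$, and $t_{i,j}\le t_{i+1,j}$, with strict inequality if $t_{i,j}\le m$. An outer corner is a box $(i,j)$ in $F_\mu^+$ (resp. $F_\mu^-$)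 such that $(i+1,j)$ and $(i,j+1)$ are not in $F_\mu^+$ (resp. not in $F_\mu^-$). The set $Out$ of outer corners is totally ordered: outer corners of $F_\mu^+$ are ordered by increasing column index $j$, those of $F_\mu^-$ by increasing row index $i$, and every outer corner of $F_\mu^+$ is smaller than every outer corner of $F_\mu^-$. **Super jeu de taquin $sjdt_c$.** Given a semistandard skew tableau and an outer corner $c$, put a star in the box $c$ (which is removed from the inner diagram) and move it by the following rules (a box "exists" if it is a box of the skew tableau, i.e. carries an entry). Suppose the star is at $(i,j)$. 1. If $i>m$: (a) if $(i+1,j)$ exists and either $(i,j+1)$ does not exist or $t_{i+1,j}<t_{i,j+1}$, exchange the star with the entry $t_{i+1,j}$ (the star moves down); (b) if $(i,j+1)$ exists and either $(i+1,j)$ does not exist or $t_{i+1,j}\not<t_{i,j+1}$, exchange the star with the entry $t_{i,j+1}$ (the star moves right); (c) if neither box exists, suppress the box $(i,j)$ and the star. 2. If $i\le m$: (a) if $(i,j+1)$ exists and either $(i+1,j)$ does not exist or $t_{i,j+1}<t_{i+1,j}$ or $t_{i,j+1}=t_{i+1,j}>m$, exchange the star with $t_{i,j+1}$ (the star moves right); (b) if $(i+1,j)$ exists and either $(i,j+1)$ does not exist or $t_{i,j+1}>t_{i+1,j}$ or $t_{i,j+1}=t_{i+1,j}\le m$, exchange the star with $t_{i+1,j}$ (the star moves down); (c) if neither box exists, suppress the box $(i,j)$ and the star. The resulting skew tableau, whose inner diagram is the former one with $c$ removed, is $sjdt_c$ of the given one. *)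

theory Defs
  imports Main
begin

text \<open>
  Boxes are pairs (row, column), both counted from 1. A filling is a partial function on boxes;
  its domain is the diagram. The parameters \<open>m\<close>, \<open>n\<close> are those of sl(m,n): rows \<open>1..m\<close> form the
  upper part of a diagram and rows \<open>> m\<close> the lower part, which has at most \<open>n - 1\<close> columns.
\<close>

type_synonym box = "nat \<times> nat"
type_synonym filling = "box \<rightharpoonup> nat"

text \<open>
  A shape is given by \<open>a 1, ..., a m\<close> and \<open>a' 1, ..., a' (n - 1)\<close>; values at other indices are never
  used. On \<^typ>\<open>nat\<close>, the supremum of the empty set is 0.
\<close>

definition is_shape :: "nat \<Rightarrow> nat \<Rightarrow> (nat \<Rightarrow> nat) \<Rightarrow> (nat \<Rightarrow> nat) \<Rightarrow> bool" where
  "is_shape m n a a' \<longleftrightarrow> Sup {j \<in> {1..n - 1}. a' j > 0} \<le> a m"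

definition ferrer_diagram :: "nat \<Rightarrow> nat \<Rightarrow> (nat \<Rightarrow> nat) \<Rightarrow> (nat \<Rightarrow> nat) \<Rightarrow> box set" where
  "ferrer_diagram m n a a' =
     {(i, j) | i j. 1 \<le> i \<and> i \<le> m \<and> 1 \<le> j \<and> j \<le> (\<Sum>k = i..m. a k)} \<union>
     {(m + i, j) | i j. 1 \<le> j \<and> j \<le> n - 1 \<and> 1 \<le> i \<and> i \<le> (\<Sum>k = j..n - 1. a' k)}"

definition tableau :: "nat \<Rightarrow> nat \<Rightarrow> filling \<Rightarrow> bool" where
  "tableau m n T \<longleftrightarrow>
     (\<exists>a a'. is_shape m n a a' \<and> dom T = ferrer_diagram m n a a') \<and> ran T \<subseteq> {1..m + n}"

definition semistandard_filling :: "nat \<Rightarrow> filling \<Rightarrow> bool" where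
  "semistandard_filling m T \<longleftrightarrow>
     (\<forall>i j x y. T (i, j) = Some x \<and> T (i, j + 1) = Some y \<longrightarrow> x \<le> y \<and> (x > m \<longrightarrow> x < y)) \<and>
     (\<forall>i j x y. T (i, j) = Some x \<and> T (i + 1, j) = Some y \<longrightarrow> x \<le> y \<and> (x \<le> m \<longrightarrow> x < y))"

definition semistandard_tableau :: "nat \<Rightarrow> nat \<Rightarrow> filling \<Rightarrow> bool" where
  "semistandard_tableau m n T \<longleftrightarrow> tableau m n T \<and> semistandard_filling m T"

text \<open>
  A pair of trivial tableaux is encoded by the row lengths \<open>B\<close> of its upper member and the column
  heights \<open>B'\<close> of its lower member. These are 0 outside \<open>1..m\<close> and \<open>1..n - 1\<close>, so that distinct
  pairs have distinct encodings.
\<close>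

type_synonym trivial_pair = "(nat \<Rightarrow> nat) \<times> (nat \<Rightarrow> nat)"

definition is_trivial_pair :: "nat \<Rightarrow> nat \<Rightarrow> trivial_pair \<Rightarrow> bool" where
  "is_trivial_pair m n S \<longleftrightarrow> (case S of (B, B') \<Rightarrow>
     antimono_on {1..m} B \<and> (\<forall>i. i \<notin> {1..m} \<longrightarrow> B i = 0) \<and>
     antimono_on {1..n - 1} B' \<and> (\<forall>j. j \<notin> {1..n - 1} \<longrightarrow> B' j = 0))"

definition upper_trivial :: "nat \<Rightarrow> trivial_pair \<Rightarrow> filling" where
  "upper_trivial m S =
     (\<lambda>(i, j). if 1 \<le> i \<and> i \<le> m \<and> 1 \<le> j \<and> j \<le> fst S i then Some i else None)"

definition lower_trivial :: "nat \<Rightarrow> nat \<Rightarrow> trivial_pair \<Rightarrow> filling" where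
  "lower_trivial m n S =
     (\<lambda>(i, j). if 1 \<le> j \<and> j \<le> n - 1 \<and> m + 1 \<le> i \<and> i \<le> m + snd S j then Some (m + j) else None)"

text \<open>The filling \<open>U\<close> left after extraction: rows \<open>\<le> m\<close> shift left, columns below them shift up.\<close>

definition extraction :: "nat \<Rightarrow> filling \<Rightarrow> trivial_pair \<Rightarrow> filling" where
  "extraction m T S =
     (\<lambda>(i, j). if i = 0 \<or> j = 0 then None
               else if i \<le> m then T (i, j + fst S i) else T (i + snd S j, j))"

definition extractable :: "nat \<Rightarrow> nat \<Rightarrow> filling \<Rightarrow> trivial_pair \<Rightarrow> bool" where
  "extractable m n T S \<longleftrightarrow>
     is_trivial_pair m n S \<and> upper_trivial m S \<subseteq>\<^sub>m T \<and> lower_trivial m n S \<subseteq>\<^sub>m T \<and>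
     semistandard_tableau m n (extraction m T S)"

definition maximal_extractable :: "nat \<Rightarrow> nat \<Rightarrow> filling \<Rightarrow> trivial_pair \<Rightarrow> bool" where
  "maximal_extractable m n T S \<longleftrightarrow>
     extractable m n T S \<and>
     (\<forall>S'. extractable m n T S' \<longrightarrow>
        upper_trivial m S' \<subseteq>\<^sub>m upper_trivial m S \<and> lower_trivial m n S' \<subseteq>\<^sub>m lower_trivial m n S)"

definition maximal_pair :: "nat \<Rightarrow> nat \<Rightarrow> filling \<Rightarrow> trivial_pair" where
  "maximal_pair m n T = (THE S. maximal_extractable m n T S)"

definition push :: "nat \<Rightarrow> nat \<Rightarrow> filling \<Rightarrow> filling" where
  "push m n T = extraction m T (maximal_pair m n T)"

text \<open>
  A skew tableau consists of its inner diagram (the emptied boxes) and the filling of the other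
  boxes. A tableau is identified with the skew tableau with empty inner diagram.
\<close>

type_synonym skew = "box set \<times> filling"

definition skew_of :: "filling \<Rightarrow> skew" where
  "skew_of T = ({}, T)"

definition remove_pair :: "nat \<Rightarrow> nat \<Rightarrow> filling \<Rightarrow> trivial_pair \<Rightarrow> skew" where
  "remove_pair m n T S =
     (let F = dom (upper_trivial m S) \<union> dom (lower_trivial m n S) in (F, T |` (- F)))"

definition upper_part :: "nat \<Rightarrow> box set \<Rightarrow> box set" where
  "upper_part m F = {c \<in> F. fst c \<le> m}"

definition lower_part :: "nat \<Rightarrow> box set \<Rightarrow> box set" where
  "lower_part m F = {c \<in> F. fst c > m}"

definition corners :: "box set \<Rightarrow> box set" where
  "corners F = {(i, j). (i, j) \<in> F \<and> (i + 1, j) \<notin> F \<and> (i, j + 1) \<notin> F}"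

definition Out :: "nat \<Rightarrow> skew \<Rightarrow> box set" where
  "Out m R = corners (upper_part m (fst R)) \<union> corners (lower_part m (fst R))"

definition corner_le :: "nat \<Rightarrow> box \<Rightarrow> box \<Rightarrow> bool" where
  "corner_le m c d \<longleftrightarrow>
     (if fst c \<le> m then fst d \<le> m \<longrightarrow> snd c \<le> snd d else fst d > m \<and> fst c \<le> fst d)"

definition greatest_corner :: "nat \<Rightarrow> skew \<Rightarrow> box" where
  "greatest_corner m R = (THE d. d \<in> Out m R \<and> (\<forall>c \<in> Out m R. corner_le m c d))"

text \<open>The box the star moves to from \<open>(i, j)\<close>, if any; \<open>x\<close> is the entry below, \<open>y\<close> the one to the right.\<close>

definition star_move :: "nat \<Rightarrow> filling \<Rightarrow> box \<Rightarrow> box option" where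
  "star_move m t = (\<lambda>(i, j).
     case (t (i + 1, j), t (i, j + 1)) of
       (None, None) \<Rightarrow> None
     | (Some x, None) \<Rightarrow> Some (i + 1, j)
     | (None, Some y) \<Rightarrow> Some (i, j + 1)
     | (Some x, Some y) \<Rightarrow>
         if i > m then (if x < y then Some (i + 1, j) else Some (i, j + 1))
         else (if y < x \<or> (y = x \<and> y > m) then Some (i, j + 1) else Some (i + 1, j)))"

text \<open>
  The star occupies the box \<open>p\<close>, which carries no entry in \<open>t\<close>. The recursion ends for every filling
  with finite domain, as the star only moves right or down.
\<close>

partial_function (tailrec) slide :: "nat \<Rightarrow> filling \<Rightarrow> box \<Rightarrow> filling" where
  "slide m t p =
     (case star_move m t p of
        None \<Rightarrow> t
      | Some q \<Rightarrow> slide m (t(p := t q, q := None)) q)"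

definition sjdt :: "nat \<Rightarrow> box \<Rightarrow> skew \<Rightarrow> skew" where
  "sjdt m c R = (fst R - {c}, slide m (snd R) c)"

text \<open>The terms after the first one with no outer corner are irrelevant.\<close>

primrec sjdt_seq :: "nat \<Rightarrow> skew \<Rightarrow> nat \<Rightarrow> skew" where
  "sjdt_seq m R 0 = R"
| "sjdt_seq m R (Suc r) = sjdt m (greatest_corner m (sjdt_seq m R r)) (sjdt_seq m R r)"

definition maxjdt :: "nat \<Rightarrow> skew \<Rightarrow> skew" where
  "maxjdt m R = sjdt_seq m R (LEAST k. Out m (sjdt_seq m R k) = {})"

end

theory Submission
  imports Defs
begin

text \<open>
  Let \<open>U\<close> be the tableau left after extracting a pair \<open>P = (B, B')\<close> from \<open>T\<close>. Then
  \<open>T\<close> with the boxes of \<open>P\<close> emptied is \<open>U\<close> with row \<open>i \<le> m\<close> shifted right by \<open>B i\<close> and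
  with the part of column \<open>j\<close> below row \<open>m\<close> shifted down by \<open>B' j\<close>; such a skew tableau is called
  \<open>inflate m U P\<close> below. Each slide of the sequence undoes one unit of one of these shifts: if \<open>d\<close> is
  the greatest outer corner, then \<open>sjdt m d (inflate m U P) = inflate m U (shrink m P d)\<close>, where
  \<open>shrink\<close> removes the box \<open>d\<close> from \<open>P\<close>. Once \<open>P\<close> is empty, only \<open>U\<close> is left. This holds for every
  extractable pair, hence the sequence ends in the semistandard tableau \<open>extraction m T P\<close>, which is
  \<open>push m n T\<close> when \<open>P\<close> is maximal.

  A slide has this effect because its star runs straight. At a corner in column \<open>j\<close> of the lower
  part, column \<open>j + 1\<close> is shifted by less than column \<open>j\<close>. So the entry to the right of the star
  comes from a box of \<open>U\<close> that lies weakly below the right neighbour of the box of \<open>U\<close> from which the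
  entry under the star comes. Semistandardness of \<open>U\<close> makes the entry under the star the smaller one
  (all entries in lower rows exceed \<open>m\<close>, so these rows are strict), and the star moves down
  (\<open>sjdt_lower_corner\<close>). The same comparison, with rows and columns exchanged, keeps the star of an
  upper corner in its row (\<open>sjdt_upper_corner\<close>). For a star in row \<open>m\<close> it involves row \<open>m + 1\<close>,
  which has to be in its original position; this is where it matters that the greatest corner is
  taken, since upper corners are then used only after all lower ones. The end of a row or column is
  covered by the same argument, because the diagram of \<open>U\<close> is an order ideal.

  The maximal pair exists because extractable pairs are closed under pointwise suprema
  (\<open>extractable_sup\<close>).
\<close>


section \<open>Ferrer diagrams as order ideals\<close>

text \<open>
  Finite order ideals of the positive quadrant. Closure is required only along steps to a
  neighbouring box, since this is what the shifted fillings below satisfy by direct comparison.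
\<close>

definition young_diagram :: "box set \<Rightarrow> bool" where
  "young_diagram F \<longleftrightarrow> finite F \<and> (\<forall>i j. (i, j) \<in> F \<longrightarrow> 1 \<le> i \<and> 1 \<le> j) \<and>
     (\<forall>i j. (Suc i, j) \<in> F \<and> 1 \<le> i \<longrightarrow> (i, j) \<in> F) \<and>
     (\<forall>i j. (i, Suc j) \<in> F \<and> 1 \<le> j \<longrightarrow> (i, j) \<in> F)"

lemma
  assumes "young_diagram F"
  shows young_diagram_finite: "finite F"
    and young_diagram_pos: "(i, j) \<in> F \<Longrightarrow> 1 \<le> i \<and> 1 \<le> j"
    and young_diagram_up: "(Suc i, j) \<in> F \<Longrightarrow> 1 \<le> i \<Longrightarrow> (i, j) \<in> F"
    and young_diagram_left: "(i, Suc j) \<in> F \<Longrightarrow> 1 \<le> j \<Longrightarrow> (i, j) \<in> F"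
  using assms unfolding young_diagram_def by blast+

lemma initial_segment_eq:
  fixes X :: "nat set"
  assumes "finite X" and "0 \<notin> X" and step: "\<And>x. Suc x \<in> X \<Longrightarrow> 1 \<le> x \<Longrightarrow> x \<in> X"
  shows "X = {1..card X}"
proof (cases "X = {}")
  case False
  have down: "x \<in> X" if "y \<in> X" "x \<le> y" "1 \<le> x" for x y
    using that(2,1)
  proof (induction rule: dec_induct)
    case (step k)
    then show ?case using assms(3)[of k] that(3) by simp
  qed
  have "X = {1..Max X}"
  proof
    show "X \<subseteq> {1..Max X}"
      using assms by (auto simp: Suc_le_eq intro: gr0I)
    show "{1..Max X} \<subseteq> X"
      using down[OF Max_in[OF assms(1) False]] by auto
  qed
  then show ?thesis
    by (metis card_atLeastAtMost add_diff_cancel_right' Suc_eq_plus1)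
qed simp

lemma sum_nat_telescope:
  fixes f :: "nat \<Rightarrow> nat"
  assumes "\<And>k. i \<le> k \<Longrightarrow> k \<le> m \<Longrightarrow> f (Suc k) \<le> f k" and "i \<le> Suc m"
  shows "(\<Sum>k = i..m. f k - f (Suc k)) = f i - f (Suc m)"
  using assms
proof (induction m)
  case 0
  then show ?case by (cases "i = 0") (auto simp: le_Suc_eq)
next
  case (Suc m)
  show ?case
  proof (cases "i = Suc (Suc m)")
    case False
    then have le: "i \<le> Suc m" using Suc.prems by simp
    have "f (Suc m) \<le> f i"
      using le Suc.prems(1) by (induction rule: dec_induct) (fastforce intro: le_trans)+
    moreover have "f (Suc (Suc m)) \<le> f (Suc m)"
      using Suc.prems(1)[of "Suc m"] le by simp
    ultimately show ?thesis
      using Suc.IH Suc.prems(1) le by simp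
  qed simp
qed

text \<open>
  The diagrams of shapes for sl(m,n) are exactly the order ideals that fit into the fat hook, that is,
  that miss the box \<open>(m + 1, n)\<close>. The condition on \<open>a m\<close> in a shape is what closure under the step
  from row \<open>m + 1\<close> to row \<open>m\<close> amounts to. This removes all bookkeeping with shapes from what follows.
\<close>

lemma young_diagram_ferrer_diagram:
  assumes m: "1 \<le> m" and n: "1 \<le> n" and shape: "is_shape m n a a'"
  shows "young_diagram (ferrer_diagram m n a a')" and "(m + 1, n) \<notin> ferrer_diagram m n a a'"
proof -
  let ?L = "\<lambda>i. \<Sum>k = i..m. a k" and ?H = "\<lambda>j. \<Sum>k = j..n - 1. a' k"
  let ?F = "ferrer_diagram m n a a'"
  have mem: "(i, j) \<in> ?F \<longleftrightarrow> 1 \<le> i \<and> 1 \<le> j \<and>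
      (if i \<le> m then j \<le> ?L i else j \<le> n - 1 \<and> i \<le> m + ?H j)" for i j
  proof (cases "i \<le> m")
    case False
    then have "i = m + (i - m)" "1 \<le> i - m" by auto
    then obtain r where "i = m + r" "1 \<le> r" by blast
    then show ?thesis by (auto simp: ferrer_diagram_def)
  qed (auto simp: ferrer_diagram_def)
  have L: "?L (Suc i) \<le> ?L i" for i
    by (rule sum_mono2) auto
  have H: "?H (Suc j) \<le> ?H j" for j
    by (rule sum_mono2) auto
  have L_le: "?L i \<le> ?L 1" if "1 \<le> i" for i
    by (rule sum_mono2) (use that in auto)
  have H_le: "?H j \<le> ?H 1" if "1 \<le> j" for j
    by (rule sum_mono2) (use that in auto)
  have row_m: "j \<le> a m" if "1 \<le> j" "j \<le> n - 1" "1 \<le> ?H j" for j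
  proof -
    obtain k where k: "k \<in> {j..n - 1}" "a' k > 0"
      using \<open>1 \<le> ?H j\<close> by (metis gr0I not_one_le_zero sum.neutral)
    then have "k \<le> Sup {j \<in> {1..n - 1}. a' j > 0}"
      by (intro le_cSup_finite) (use that in auto)
    then show ?thesis using shape k by (auto simp: is_shape_def)
  qed
  have "?F \<subseteq> {1..m + ?H 1} \<times> {1..?L 1 + n}"
  proof
    fix p assume "p \<in> ?F"
    then show "p \<in> {1..m + ?H 1} \<times> {1..?L 1 + n}"
      using L_le[of "fst p"] H_le[of "snd p"] mem[of "fst p" "snd p"]
      by (cases p) (auto split: if_splits)
  qed
  then have "finite ?F" by (rule finite_subset) simp
  moreover have "(i, j) \<in> ?F" if "(Suc i, j) \<in> ?F" "1 \<le> i" for i j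
  proof (cases "i = m")
    case True
    then have "j \<le> a m" using that row_m[of j] unfolding mem by auto
    then show ?thesis using that True unfolding mem by auto
  next
    case False
    then show ?thesis using that L[of i] unfolding mem by (auto split: if_splits)
  qed
  moreover have "(i, j) \<in> ?F" if "(i, Suc j) \<in> ?F" "1 \<le> j" for i j
    using that H[of j] unfolding mem by (auto split: if_splits)
  ultimately show "young_diagram ?F" using mem unfolding young_diagram_def by blast
  show "(m + 1, n) \<notin> ?F" using n unfolding mem by auto
qed

text \<open>
  Conversely, the numbers \<open>a i\<close> and \<open>a' j\<close> are the differences of consecutive row lengths and of
  consecutive column heights, and the sums in the diagram telescope.
\<close>

lemma young_diagram_imp_ferrer_diagram:
  assumes m: "1 \<le> m" and n: "1 \<le> n" and F: "young_diagram F" and corner: "(m + 1, n) \<notin> F"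
  shows "\<exists>a a'. is_shape m n a a' \<and> F = ferrer_diagram m n a a'"
proof -
  have fin: "finite F" and pos: "\<And>i j. (i, j) \<in> F \<Longrightarrow> 1 \<le> i \<and> 1 \<le> j"
    and up: "\<And>i j. (Suc i, j) \<in> F \<Longrightarrow> 1 \<le> i \<Longrightarrow> (i, j) \<in> F"
    and left: "\<And>i j. (i, Suc j) \<in> F \<Longrightarrow> 1 \<le> j \<Longrightarrow> (i, j) \<in> F"
    using F unfolding young_diagram_def by blast+
  \<comment> \<open>The cut-off at row \<open>m\<close> makes the last difference equal to the length of row \<open>m\<close>.\<close>
  define row where "row i = {j. i \<le> m \<and> (i, j) \<in> F}" for i
  define col where "col j = {i. 1 \<le> i \<and> (m + i, j) \<in> F}" for j
  have fin_row: "finite (row i)" for i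
    by (rule finite_subset[OF _ finite_imageI[OF fin, of snd]]) (force simp: row_def)
  have fin_col: "finite (col j)" for j
  proof (rule finite_subset[OF _ finite_imageI[OF fin, of "\<lambda>p. fst p - m"]])
    show "col j \<subseteq> (\<lambda>p. fst p - m) ` F" by (force simp: col_def)
  qed
  have row: "row i = {1..card (row i)}" for i
    by (rule initial_segment_eq[OF fin_row]) (use pos left in \<open>force simp: row_def\<close>)+
  have col: "col j = {1..card (col j)}" for j
    by (rule initial_segment_eq[OF fin_col]) (use up m in \<open>force simp: col_def\<close>)+
  have row_mono: "card (row (Suc i)) \<le> card (row i)" if "1 \<le> i" for i
    by (rule card_mono[OF fin_row]) (use up that in \<open>auto simp: row_def\<close>)
  have col_mono: "card (col (Suc j)) \<le> card (col j)" if "1 \<le> j" for j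
    by (rule card_mono[OF fin_col]) (use left that in \<open>auto simp: col_def\<close>)
  have row_end: "card (row (Suc m)) = 0" by (simp add: row_def)
  have "1 \<notin> col n" using corner by (simp add: col_def)
  then have col_end: "card (col n) = 0" 
    using col[of n] by (cases "card (col n)") auto
  define a where "a i = card (row i) - card (row (Suc i))" for i
  define a' where "a' j = card (col j) - card (col (Suc j))" for j
  have sum_a: "(\<Sum>k = i..m. a k) = card (row i)" if "1 \<le> i" "i \<le> m" for i
    using sum_nat_telescope[of i m "\<lambda>i. card (row i)"] row_mono row_end that by (simp add: a_def)
  have sum_a': "(\<Sum>k = j..n - 1. a' k) = card (col j)" if "1 \<le> j" "j \<le> n - 1" for j
    using sum_nat_telescope[of j "n - 1" "\<lambda>j. card (col j)"] col_mono col_end that n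
    by (simp add: a'_def)
  have lower_col: "j \<le> n - 1" if "(m + i, j) \<in> F" "1 \<le> i" for i j
  proof (rule ccontr)
    assume "\<not> j \<le> n - 1"
    then have "n \<le> j" using n by simp
    have "i \<in> col j" using that by (simp add: col_def)
    have "card (col j) \<le> card (col n)"
      using \<open>n \<le> j\<close>
    proof (induction rule: dec_induct)
      case (step k)
      then show ?case using col_mono[of k] n by simp
    qed simp
    then show False using \<open>i \<in> col j\<close> col_end fin_col[of j] by auto
  qed
  have "F = ferrer_diagram m n a a'"
  proof (intro set_eqI)
    fix p :: box
    obtain i j where p: "p = (i, j)" by (cases p)
    show "p \<in> F \<longleftrightarrow> p \<in> ferrer_diagram m n a a'"
    proof (cases "i \<le> m")
      case True
      have "(i, j) \<in> F \<longleftrightarrow> 1 \<le> i \<and> j \<in> row i" using pos True by (auto simp: row_def)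
      also have "\<dots> \<longleftrightarrow> 1 \<le> i \<and> 1 \<le> j \<and> j \<le> card (row i)" by (subst row) auto
      also have "\<dots> \<longleftrightarrow> (i, j) \<in> ferrer_diagram m n a a'"
        using True sum_a by (auto simp: ferrer_diagram_def)
      finally show ?thesis by (simp add: p)
    next
      case False
      then have "i = m + (i - m)" "1 \<le> i - m" by auto
      then obtain r where r: "i = m + r" "1 \<le> r" by blast
      have "(i, j) \<in> F \<longleftrightarrow> r \<in> col j" using r by (auto simp: col_def)
      also have "\<dots> \<longleftrightarrow> 1 \<le> j \<and> j \<le> n - 1 \<and> r \<in> col j"
        using pos lower_col by (auto simp: col_def)
      also have "\<dots> \<longleftrightarrow> 1 \<le> j \<and> j \<le> n - 1 \<and> r \<le> card (col j)" using r by (subst col) auto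
      also have "\<dots> \<longleftrightarrow> (i, j) \<in> ferrer_diagram m n a a'"
        using r sum_a' by (auto simp: ferrer_diagram_def)
      finally show ?thesis by (simp add: p)
    qed
  qed
  moreover have "Sup {j \<in> {1..n - 1}. a' j > 0} \<le> a m"
  proof (cases "{j \<in> {1..n - 1}. a' j > 0} = {}")
    case True
    then show ?thesis by (simp only: True) (simp add: Sup_nat_def)
  next
    case False
    have "j \<le> a m" if "a' j > 0" for j
    proof -
      have "1 \<in> col j" using that by (subst col) (simp add: a'_def)
      then have "(m, j) \<in> F" using up[of m j] m by (simp add: col_def)
      then have "j \<in> row m" by (simp add: row_def)
      then show ?thesis using row[of m] row_end by (auto simp: a_def)
    qed
    then show ?thesis by (intro cSup_least[OF False]) auto
  qed
  ultimately show ?thesis unfolding is_shape_def by blast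
qed

lemma tableau_iff:
  assumes "1 \<le> m" and "1 \<le> n"
  shows "tableau m n T \<longleftrightarrow>
    young_diagram (dom T) \<and> (m + 1, n) \<notin> dom T \<and> ran T \<subseteq> {1..m + n}"
  unfolding tableau_def
  using young_diagram_ferrer_diagram[OF assms] young_diagram_imp_ferrer_diagram[OF assms, of "dom T"]
  by metis

section \<open>Semistandard tableaux\<close>

lemma entry_mono:
  assumes "young_diagram (dom U)" and "semistandard_filling m U"
    and "U (i', j') = Some y" and "1 \<le> i" "i \<le> i'" and "1 \<le> j" "j \<le> j'"
  shows "\<exists>x. U (i, j) = Some x \<and> x \<le> y"
proof -
  have up: "\<exists>x. U (r, c) = Some x \<and> x \<le> y" if "U (Suc r, c) = Some y" "1 \<le> r" for r c y
    using that assms(1,2) unfolding young_diagram_def semistandard_filling_def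
    by (metis Suc_eq_plus1 domD domI)
  have left: "\<exists>x. U (r, c) = Some x \<and> x \<le> y" if "U (r, Suc c) = Some y" "1 \<le> c" for r c y
    using that assms(1,2) unfolding young_diagram_def semistandard_filling_def
    by (metis Suc_eq_plus1 domD domI)
  have "\<exists>x. U (i, j') = Some x \<and> x \<le> y"
    using assms(5,3,4)
  proof (induction arbitrary: y rule: dec_induct)
    case (step k)
    obtain z where "U (k, j') = Some z" "z \<le> y" using up[OF step(4)] step by auto
    then show ?case using step by (meson le_trans)
  qed simp
  then obtain z where z: "U (i, j') = Some z" "z \<le> y" by blast
  have "\<exists>x. U (i, j) = Some x \<and> x \<le> z"
    using assms(7) z(1) assms(6)
  proof (induction arbitrary: z rule: dec_induct)
    case (step k)
    obtain w where "U (i, k) = Some w" "w \<le> z" using left[OF step(4)] step by auto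
    then show ?case using step by (meson le_trans)
  qed simp
  then show ?thesis using z(2) by (meson le_trans)
qed

text \<open>
  As long as the entries of a column are at most \<open>m\<close>, they increase strictly, so the entry in row \<open>i\<close>
  is at least \<open>i\<close>.
\<close>

lemma lower_entry_gt:
  assumes "young_diagram (dom U)" and "semistandard_filling m U" and "0 \<notin> ran U"
    and "U (i, j) = Some x" and "m < i"
  shows "m < x"
proof -
  have "i \<le> x \<or> m < x"
    using assms(4)
  proof (induction i arbitrary: x)
    case (Suc i)
    show ?case
    proof (cases "i = 0")
      case True
      then show ?thesis using Suc.prems assms(3) by (metis Suc_le_eq gr0I ranI)
    next
      case False
      then obtain y where y: "U (i, j) = Some y"
        using Suc.prems assms(1) unfolding young_diagram_def by (metis domD domI One_nat_def Suc_leI gr0I)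
      then have "y \<le> x \<and> (y \<le> m \<longrightarrow> y < x)"
        using Suc.prems assms(2) unfolding semistandard_filling_def by (metis Suc_eq_plus1)
      then show ?thesis using Suc.IH[OF y] by auto
    qed
  qed simp
  then show ?thesis using assms(5) by auto
qed

section \<open>Sliding along a known path\<close>

lemma star_move_cases:
  "star_move m t (i, j) = Some q \<Longrightarrow> q = (i + 1, j) \<or> q = (i, j + 1)"
  by (auto simp: star_move_def split: option.splits if_splits)

lemma star_move_cong:
  assumes "t (i + 1, j) = s (i + 1, j)" and "t (i, j + 1) = s (i, j + 1)"
  shows "star_move m t (i, j) = star_move m s (i, j)"
  by (simp only: star_move_def prod.case assms)

text \<open>
  The moves of the star can be read off the original filling: the slide has changed only boxes of the
  path, all of which have a smaller sum of coordinates than the two boxes that decide the next move.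
\<close>

lemma slide_path:
  assumes "t (q 0) = None"
    and "\<And>k. k < N \<Longrightarrow> star_move m t (q k) = Some (q (Suc k))"
    and "star_move m t (q N) = None"
    and "\<And>k. k < N \<Longrightarrow> t' (q k) = t (q (Suc k))" and "t' (q N) = None"
    and "\<And>p. p \<notin> q ` {..N} \<Longrightarrow> t' p = t p"
  shows "slide m t (q 0) = t'"
  using assms
proof (induction N arbitrary: q t)
  case 0
  have "t' = t" using 0 by (intro ext) (metis atMost_0 image_empty image_insert singletonD)
  then show ?case using 0(3) by (simp add: slide.simps[of m t])
next
  case (Suc N)
  note moves_t = Suc.prems(2)
  define s where "s = t(q 0 := t (q 1), q 1 := None)"
  define level :: "box \<Rightarrow> nat" where "level p = fst p + snd p" for p
  have level: "level (q k) = level (q 0) + k" if "k \<le> Suc N" for k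
    using that
  proof (induction k)
    case (Suc k)
    obtain i j where ij: "q k = (i, j)" by (cases "q k")
    have "star_move m t (i, j) = Some (q (Suc k))"
      using Suc.prems moves_t[of k] ij by simp
    then have "level (q (Suc k)) = Suc (level (q k))"
      using star_move_cases ij by (fastforce simp: level_def)
    then show ?case using Suc by simp
  qed simp
  have level1: "level (q 1) = Suc (level (q 0))" using level[of 1] by simp
  have moves: "star_move m s (q (Suc k)) = star_move m t (q (Suc k))" if "k \<le> N" for k
  proof -
    obtain i j where ij: "q (Suc k) = (i, j)" by (cases "q (Suc k)")
    have "s p = t p" if "level p > level (q 1)" for p
    proof -
      have "p \<noteq> q 0" and "p \<noteq> q 1" using that level1 by fastforce+
      then show ?thesis by (simp add: s_def)
    qed
    moreover have "level (q 1) \<le> level (i, j)" using level[of "Suc k"] level1 that ij by simp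
    ultimately show ?thesis unfolding ij by (intro star_move_cong) (auto simp: level_def)
  qed
  have "slide m s (q 1) = t'"
  proof -
    have "slide m s ((q \<circ> Suc) 0) = t'"
    proof (rule Suc.IH)
      show "s ((q \<circ> Suc) 0) = None" by (simp add: s_def)
      show "star_move m s ((q \<circ> Suc) k) = Some ((q \<circ> Suc) (Suc k))" if "k < N" for k
        using that moves[of k] Suc.prems(2)[of "Suc k"] by simp
      show "star_move m s ((q \<circ> Suc) N) = None" using moves[of N] Suc.prems(3) by simp
      show "t' ((q \<circ> Suc) k) = s ((q \<circ> Suc) (Suc k))" if "k < N" for k
      proof -
        have "q (Suc (Suc k)) \<noteq> q 0" "q (Suc (Suc k)) \<noteq> q 1"
          using level[of "Suc (Suc k)"] level1 that by auto
        then show ?thesis using Suc.prems(4)[of "Suc k"] that by (simp add: s_def)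
      qed
      show "t' ((q \<circ> Suc) N) = None" using Suc.prems(5) by simp
      show "t' p = s p" if "p \<notin> (q \<circ> Suc) ` {..N}" for p
      proof (cases "p = q 0")
        case True
        have "q 0 \<noteq> q 1" using level1 by auto
        then show ?thesis using True Suc.prems(4)[of 0] by (simp add: s_def)
      next
        case False
        have "p \<noteq> q 1" using that by (auto simp: image_iff)
        moreover have "p \<notin> q ` {..Suc N}"
          using that False by (auto simp: image_iff) (metis atMost_iff not0_implies_Suc Suc_le_mono)
        ultimately show ?thesis using False Suc.prems(6) by (simp add: s_def)
      qed
    qed
    then show ?thesis by simp
  qed
  moreover have "star_move m t (q 0) = Some (q 1)" using Suc.prems(2)[of 0] by simp
  ultimately show ?case by (simp add: slide.simps[of m t] s_def)
qed

section \<open>Skew tableaux obtained by shifting a tableau away from its inner diagram\<close>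

text \<open>
  As the row lengths and column heights vanish beyond the last index, their monotonicity holds across
  it too, and the last row and column are not special cases.
\<close>

lemma is_trivial_pair_iff:
  "is_trivial_pair m n P \<longleftrightarrow>
     fst P 0 = 0 \<and> (\<forall>i>m. fst P i = 0) \<and> (\<forall>i\<ge>1. fst P (Suc i) \<le> fst P i) \<and>
     snd P 0 = 0 \<and> (\<forall>j>n - 1. snd P j = 0) \<and> (\<forall>j\<ge>1. snd P (Suc j) \<le> snd P j)"
proof -
  have *: "antimono_on {1..N} f \<and> (\<forall>i. i \<notin> {1..N} \<longrightarrow> f i = 0) \<longleftrightarrow>
      f 0 = 0 \<and> (\<forall>i>N. f i = 0) \<and> (\<forall>i\<ge>1. f (Suc i) \<le> f i)" for N and f :: "nat \<Rightarrow> nat"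
  proof
    assume L: "antimono_on {1..N} f \<and> (\<forall>i. i \<notin> {1..N} \<longrightarrow> f i = 0)"
    have "f (Suc i) \<le> f i" if "i \<ge> 1" for i
    proof (cases "Suc i \<le> N")
      case True
      then show ?thesis using L that by (auto simp: monotone_on_def)
    qed (use L in auto)
    then show "f 0 = 0 \<and> (\<forall>i>N. f i = 0) \<and> (\<forall>i\<ge>1. f (Suc i) \<le> f i)" using L by auto
  next
    assume R: "f 0 = 0 \<and> (\<forall>i>N. f i = 0) \<and> (\<forall>i\<ge>1. f (Suc i) \<le> f i)"
    have "f y \<le> f x" if "x \<le> y" "1 \<le> x" for x y
      using that(1)
    proof (induction rule: dec_induct)
      case (step k)
      then show ?case using R that(2) by (meson le_trans)
    qed simp
    then have "antimono_on {1..N} f" by (auto intro: monotone_onI)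
    moreover have "f i = 0" if "i \<notin> {1..N}" for i using R that by (cases "i = 0") auto
    ultimately show "antimono_on {1..N} f \<and> (\<forall>i. i \<notin> {1..N} \<longrightarrow> f i = 0)" by blast
  qed
  show ?thesis
    using *[of m "fst P"] *[of "n - 1" "snd P"] unfolding is_trivial_pair_def case_prod_beta
    by blast
qed

definition inner_diagram :: "nat \<Rightarrow> trivial_pair \<Rightarrow> box set" where
  "inner_diagram m P = {(i, j). 1 \<le> j \<and> (if i \<le> m then j \<le> fst P i else i \<le> m + snd P j)}"

text \<open>
  The inverse of extraction: rows of \<open>U\<close> are shifted right and lower columns shifted down to make
  room for the emptied boxes.
\<close>

definition inflate :: "nat \<Rightarrow> filling \<Rightarrow> trivial_pair \<Rightarrow> skew" where
  "inflate m U P = (inner_diagram m P,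
     (\<lambda>(i, j). if i \<le> m then (if j \<le> fst P i then None else U (i, j - fst P i))
               else (if i \<le> m + snd P j then None else U (i - snd P j, j))))"

lemma inner_diagram_eq:
  assumes "is_trivial_pair m n P"
  shows "inner_diagram m P = dom (upper_trivial m P) \<union> dom (lower_trivial m n P)"
proof (intro set_eqI)
  fix p :: box
  obtain i j where p: "p = (i, j)" by (cases p)
  have "1 \<le> i" if "1 \<le> j" "j \<le> fst P i"
    using that assms by (cases "i = 0") (auto simp: is_trivial_pair_iff)
  moreover have "j \<le> n - 1" if "\<not> i \<le> m" "i \<le> m + snd P j"
    using that assms by (cases "j \<le> n - 1") (auto simp: is_trivial_pair_iff)
  moreover have "p \<in> dom (upper_trivial m P) \<longleftrightarrow> 1 \<le> i \<and> i \<le> m \<and> 1 \<le> j \<and> j \<le> fst P i"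
    by (simp add: p domIff upper_trivial_def)
  moreover have "p \<in> dom (lower_trivial m n P) \<longleftrightarrow>
      1 \<le> j \<and> j \<le> n - 1 \<and> m + 1 \<le> i \<and> i \<le> m + snd P j"
    by (simp add: p domIff lower_trivial_def)
  moreover have "p \<in> inner_diagram m P \<longleftrightarrow>
      1 \<le> j \<and> (if i \<le> m then j \<le> fst P i else i \<le> m + snd P j)"
    by (simp add: p inner_diagram_def)
  ultimately show "p \<in> inner_diagram m P \<longleftrightarrow>
      p \<in> dom (upper_trivial m P) \<union> dom (lower_trivial m n P)"
    unfolding Un_iff by (metis Suc_eq_plus1 not_less_eq_eq)
qed

lemma remove_pair_eq_inflate:
  assumes "is_trivial_pair m n P" and "young_diagram (dom T)"
  shows "remove_pair m n T P = inflate m (extraction m T P) P"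
proof -
  have none: "T (i, j) = None" if "i = 0 \<or> j = 0" for i j
    using assms(2) that unfolding young_diagram_def by (metis domIff not_one_le_zero)
  have zero: "fst P 0 = 0" "snd P 0 = 0" using assms(1) by (auto simp: is_trivial_pair_iff)
  have "(T |` (- inner_diagram m P)) (i, j) = snd (inflate m (extraction m T P) P) (i, j)" for i j
    using none[of i j] zero
    by (auto simp: inflate_def extraction_def inner_diagram_def restrict_map_def)
  then show ?thesis
    unfolding remove_pair_def Let_def inner_diagram_eq[OF assms(1), symmetric]
    by (auto simp: inflate_def intro!: ext)
qed

lemma inflate_empty_inner:
  assumes "is_trivial_pair m n P" and "young_diagram (dom U)" and "inner_diagram m P = {}"
  shows "inflate m U P = skew_of U"
proof -
  have none: "U (i, 0) = None" for i
    using assms(2) unfolding young_diagram_def by (metis domIff not_one_le_zero)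
  have "fst P i = 0" if "i \<le> m" for i
  proof (rule ccontr)
    assume "fst P i \<noteq> 0"
    then have "(i, 1) \<in> inner_diagram m P" using that by (simp add: inner_diagram_def)
    then show False using assms(3) by simp
  qed
  moreover have "snd P j = 0" for j
  proof (rule ccontr)
    assume nz: "snd P j \<noteq> 0"
    then have "1 \<le> j" using assms(1) by (cases "j = 0") (auto simp: is_trivial_pair_iff)
    then have "(m + 1, j) \<in> inner_diagram m P" using nz by (simp add: inner_diagram_def)
    then show False using assms(3) by simp
  qed
  ultimately show ?thesis
    unfolding inflate_def skew_of_def using none assms(3) by (auto intro!: ext)
qed

section \<open>Sliding into an outer corner\<close>

text \<open>
  An upper corner \<open>c\<close> ends a row of length \<open>snd c\<close>; a lower corner \<open>c\<close> ends a column of height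
  \<open>fst c - m\<close>.
\<close>

definition shrink :: "nat \<Rightarrow> trivial_pair \<Rightarrow> box \<Rightarrow> trivial_pair" where
  "shrink m P c =
     (if fst c \<le> m then ((fst P)(fst c := snd c - 1), snd P)
      else (fst P, (snd P)(snd c := fst c - m - 1)))"

lemma upper_cornerD:
  assumes "is_trivial_pair m n P" and "(i, j) \<in> corners (upper_part m (inner_diagram m P))"
  shows "1 \<le> i" and "i \<le> m" and "1 \<le> j" and "fst P i = j" and "fst P (Suc i) < j"
proof -
  show i: "i \<le> m" and j: "1 \<le> j" and eq: "fst P i = j"
    using assms(2) by (auto simp: corners_def upper_part_def inner_diagram_def)
  show "1 \<le> i" using assms(1) eq j by (cases "i = 0") (auto simp: is_trivial_pair_iff)
  show "fst P (Suc i) < j"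
  proof (cases "Suc i \<le> m")
    case True
    then show ?thesis using assms(2) by (auto simp: corners_def upper_part_def inner_diagram_def)
  next
    case False
    then show ?thesis using assms(1) j by (auto simp: is_trivial_pair_iff)
  qed
qed

lemma lower_cornerD:
  assumes "(i, j) \<in> corners (lower_part m (inner_diagram m P))"
  shows "m < i" and "1 \<le> j" and "i = m + snd P j" and "snd P (Suc j) < snd P j"
  using assms by (auto simp: corners_def lower_part_def inner_diagram_def)

lemma shrink_upper_corner:
  assumes "is_trivial_pair m n P" and "c \<in> corners (upper_part m (inner_diagram m P))"
  shows "is_trivial_pair m n (shrink m P c)"
    and "inner_diagram m (shrink m P c) = inner_diagram m P - {c}"
proof -
  obtain i j where c: "c = (i, j)" by (cases c)
  note d = upper_cornerD[OF assms(1) assms(2)[unfolded c]]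
  show "is_trivial_pair m n (shrink m P c)"
    using assms(1) d unfolding is_trivial_pair_iff shrink_def c by (fastforce simp: le_diff_conv)
  show "inner_diagram m (shrink m P c) = inner_diagram m P - {c}"
    using d by (auto simp: inner_diagram_def shrink_def c split: if_splits)
qed

lemma shrink_lower_corner:
  assumes "is_trivial_pair m n P" and "c \<in> corners (lower_part m (inner_diagram m P))"
  shows "is_trivial_pair m n (shrink m P c)"
    and "inner_diagram m (shrink m P c) = inner_diagram m P - {c}"
proof -
  obtain i j where c: "c = (i, j)" by (cases c)
  note d = lower_cornerD[OF assms(2)[unfolded c]]
  show "is_trivial_pair m n (shrink m P c)"
    using assms(1) d unfolding is_trivial_pair_iff shrink_def c by (fastforce simp: le_diff_conv)
  show "inner_diagram m (shrink m P c) = inner_diagram m P - {c}"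
    using d by (auto simp: inner_diagram_def shrink_def c split: if_splits)
qed

text \<open>
  The star runs to the bottom of its column. Its \<open>k\<close>-th position has below it the entry
  \<open>U (m + k + 1, j)\<close> and to its right an entry of column \<open>j + 1\<close> of \<open>U\<close> from row \<open>m + k + 1\<close> or
  further down, because column \<open>j + 1\<close> is shifted by less than \<open>h\<close>.
\<close>

lemma sjdt_lower_corner:
  assumes "young_diagram (dom U)" and "semistandard_filling m U" and "0 \<notin> ran U"
    and P: "is_trivial_pair m n P" and c: "c \<in> corners (lower_part m (inner_diagram m P))"
  shows "sjdt m c (inflate m U P) = inflate m U (shrink m P c)"
proof -
  obtain i j where ij: "c = (i, j)" by (cases c)
  define h where "h = snd P j"
  have d: "1 \<le> j" "i = m + h" "snd P (Suc j) < h" "1 \<le> h"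
    using lower_cornerD[OF c[unfolded ij]] by (auto simp: h_def)
  define X where "X = {k. 1 \<le> k \<and> (m + k, j) \<in> dom U}"
  have X: "X = {1..card X}"
  proof (rule initial_segment_eq)
    have "X \<subseteq> (\<lambda>p. fst p - m) ` dom U" by (force simp: X_def)
    then show "finite X"
      by (rule finite_subset) (simp add: young_diagram_finite[OF assms(1)])
    show "0 \<notin> X" by (simp add: X_def)
    show "k \<in> X" if "Suc k \<in> X" "1 \<le> k" for k
      using young_diagram_up[OF assms(1), of "m + k" j] that by (simp add: X_def)
  qed
  define N where "N = card X"
  have col: "U (m + k, j) = None \<longleftrightarrow> N < k" if "1 \<le> k" for k
  proof -
    have "k \<in> X \<longleftrightarrow> k \<le> N" using that by (subst X) (simp add: N_def)
    then show ?thesis using that by (auto simp: X_def)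
  qed
  define t where "t = snd (inflate m U P)"
  have below: "t (m + h + k + 1, j) = U (m + k + 1, j)" for k
    by (simp add: t_def inflate_def h_def)
  have right: "t (m + h + k, j + 1) = U (m + h + k - snd P (Suc j), j + 1)" for k
    using d by (auto simp: t_def inflate_def)
  have right_of: "\<exists>z. U (m + k + 1, j + 1) = Some z \<and> z \<le> y"
    if "t (m + h + k, j + 1) = Some y" for k y
    by (rule entry_mono[OF assms(1,2) that[unfolded right]]) (use d in auto)
  have "slide m t ((\<lambda>k. (i + k, j)) 0) = snd (inflate m U (shrink m P c))"
  proof (rule slide_path)
    show "t (i + 0, j) = None" using d by (simp add: t_def inflate_def h_def)
    show "star_move m t (i + k, j) = Some (i + Suc k, j)" if "k < N" for k
    proof -
      have "U (m + k + 1, j) \<noteq> None" using col[of "k + 1"] that by simp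
      then obtain x where x: "U (m + k + 1, j) = Some x" by blast
      have "x < y" if y: "t (m + h + k, j + 1) = Some y" for y
      proof -
        obtain z where z: "U (m + k + 1, j + 1) = Some z" "z \<le> y" using right_of[OF y] by blast
        have "m < x" using lower_entry_gt[OF assms(1-3) x] by simp
        then have "x < z" using assms(2) x z(1) unfolding semistandard_filling_def by blast
        then show ?thesis using z(2) by simp
      qed
      then show ?thesis
        using below[of k] x d(2,4) by (cases "t (m + h + k, j + 1)") (auto simp: star_move_def)
    qed
    show "star_move m t (i + N, j) = None"
    proof -
      have "U (m + N + 1, j) = None" using col[of "N + 1"] by simp
      moreover from this have "U (m + N + 1, j + 1) = None"
        using assms(1) d(1) unfolding young_diagram_def by (metis Suc_eq_plus1 domIff)
      ultimately have "t (m + h + N + 1, j) = None" "t (m + h + N, j + 1) = None"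
        using below[of N] right_of[of N] by (auto simp del: not_None_eq) (metis not_None_eq)
      then show ?thesis using d(2) by (simp add: star_move_def)
    qed
    show "snd (inflate m U (shrink m P c)) (i + k, j) = t (i + Suc k, j)" if "k < N" for k
    proof -
      have "\<not> h + k \<le> h - 1" using d(4) by arith
      then show ?thesis using d by (simp add: t_def inflate_def shrink_def ij h_def[symmetric])
    qed
    show "snd (inflate m U (shrink m P c)) (i + N, j) = None"
      using d col[of "N + 1"] by (simp add: inflate_def shrink_def ij h_def[symmetric])
    show "snd (inflate m U (shrink m P c)) p = t p" if "p \<notin> (\<lambda>k. (i + k, j)) ` {..N}" for p
    proof -
      obtain a b where p: "p = (a, b)" by (cases p)
      show ?thesis
      proof (cases "b = j \<and> m + h \<le> a")
        case True
        then obtain k where k: "a = i + k" using d(2) le_Suc_ex by blast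
        then have "N < k" using that p True by (auto simp: image_iff)
        then show ?thesis
          using d True k p col[of k] col[of "Suc k"]
          by (simp add: t_def inflate_def shrink_def ij h_def[symmetric])
      next
        case False
        then show ?thesis
          using d p by (auto simp: t_def inflate_def shrink_def ij h_def[symmetric])
      qed
    qed
  qed
  then show ?thesis
    using shrink_lower_corner(2)[OF P c]
    by (simp add: sjdt_def t_def ij prod_eq_iff) (simp add: inflate_def)
qed

text \<open>
  The star runs to the end of its row: below it lies an entry of row \<open>i + 1\<close> of \<open>U\<close> from column
  \<open>k + 1\<close> or further right, to be compared with \<open>U (i, k + 1)\<close>. For \<open>i = m\<close> this needs row
  \<open>m + 1\<close> in its original position, which is ensured by the lower part of the pair being empty.
\<close>

lemma sjdt_upper_corner:
  assumes "young_diagram (dom U)" and "semistandard_filling m U"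
    and P: "is_trivial_pair m n P" and c: "c \<in> corners (upper_part m (inner_diagram m P))"
    and lower: "\<And>j. snd P j = 0"
  shows "sjdt m c (inflate m U P) = inflate m U (shrink m P c)"
proof -
  obtain i j where ij: "c = (i, j)" by (cases c)
  note d = upper_cornerD[OF P c[unfolded ij]]
  define X where "X = {k. (i, k) \<in> dom U}"
  have X: "X = {1..card X}"
  proof (rule initial_segment_eq)
    have "X \<subseteq> snd ` dom U" by (force simp: X_def)
    then show "finite X"
      by (rule finite_subset) (simp add: young_diagram_finite[OF assms(1)])
    show "0 \<notin> X" using young_diagram_pos[OF assms(1), of i 0] by (auto simp: X_def)
    show "k \<in> X" if "Suc k \<in> X" "1 \<le> k" for k
      using young_diagram_left[OF assms(1), of i k] that by (simp add: X_def)
  qed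
  define N where "N = card X"
  have row: "U (i, k) = None \<longleftrightarrow> N < k" if "1 \<le> k" for k
  proof -
    have "k \<in> X \<longleftrightarrow> k \<le> N" using that by (subst X) (simp add: N_def)
    then show ?thesis by (auto simp: X_def)
  qed
  define t where "t = snd (inflate m U P)"
  have right: "t (i, j + k + 1) = U (i, k + 1)" for k
    using d by (simp add: t_def inflate_def)
  have below: "t (i + 1, j + k) = U (i + 1, j + k - fst P (Suc i))" for k
    using d lower P by (auto simp: t_def inflate_def is_trivial_pair_iff)
  have below_of: "\<exists>z. U (i + 1, k + 1) = Some z \<and> z \<le> x" if "t (i + 1, j + k) = Some x" for k x
    by (rule entry_mono[OF assms(1,2) that[unfolded below]]) (use d in auto)
  have "slide m t ((\<lambda>k. (i, j + k)) 0) = snd (inflate m U (shrink m P c))"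
  proof (rule slide_path)
    show "t (i, j + 0) = None" using d by (simp add: t_def inflate_def)
    show "star_move m t (i, j + k) = Some (i, j + Suc k)" if "k < N" for k
    proof -
      have "U (i, k + 1) \<noteq> None" using row[of "k + 1"] that by simp
      then obtain y where y: "U (i, k + 1) = Some y" by blast
      \<comment> \<open>A tie still sends the star to the right, as equal entries in a column exceed \<open>m\<close>.\<close>
      have "y < x \<or> (y = x \<and> y > m)" if x: "t (i + 1, j + k) = Some x" for x
      proof -
        obtain z where z: "U (i + 1, k + 1) = Some z" "z \<le> x" using below_of[OF x] by blast
        have "y \<le> z \<and> (y \<le> m \<longrightarrow> y < z)"
          using assms(2) y z(1) unfolding semistandard_filling_def by blast
        then show ?thesis using z(2) by auto
      qed
      then show ?thesis
        using right[of k] y d(2) by (cases "t (i + 1, j + k)") (auto simp: star_move_def)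
    qed
    show "star_move m t (i, j + N) = None"
    proof -
      have "U (i, N + 1) = None" using row[of "N + 1"] by simp
      moreover from this have "U (i + 1, N + 1) = None"
        using assms(1) d(1) unfolding young_diagram_def by (metis Suc_eq_plus1 domIff)
      ultimately have "t (i, j + N + 1) = None" "t (i + 1, j + N) = None"
        using right[of N] below_of[of N] by (auto simp del: not_None_eq) (metis not_None_eq)
      then show ?thesis by (simp add: star_move_def)
    qed
    show "snd (inflate m U (shrink m P c)) (i, j + k) = t (i, j + Suc k)" if "k < N" for k
    proof -
      have "\<not> j + k \<le> j - 1" using d(3) by arith
      then show ?thesis using d by (simp add: t_def inflate_def shrink_def ij)
    qed
    show "snd (inflate m U (shrink m P c)) (i, j + N) = None"
      using d row[of "N + 1"] by (simp add: inflate_def shrink_def ij)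
    show "snd (inflate m U (shrink m P c)) p = t p" if "p \<notin> (\<lambda>k. (i, j + k)) ` {..N}" for p
    proof -
      obtain a b where p: "p = (a, b)" by (cases p)
      show ?thesis
      proof (cases "a = i \<and> j \<le> b")
        case True
        then obtain k where k: "b = j + k" using le_Suc_ex by blast
        then have "N < k" using that p True by (auto simp: image_iff)
        then show ?thesis
          using d True k p row[of k] row[of "Suc k"]
          by (simp add: t_def inflate_def shrink_def ij)
      next
        case False
        then show ?thesis
          using d p by (auto simp: t_def inflate_def shrink_def ij)
      qed
    qed
  qed
  then show ?thesis
    using shrink_upper_corner(2)[OF P c]
    by (simp add: sjdt_def t_def ij prod_eq_iff) (simp add: inflate_def)
qed

section \<open>Emptying the inner diagram\<close>

lemma finite_nonempty_has_corner:
  assumes "finite F" and "F \<noteq> {}"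
  shows "corners F \<noteq> {}"
proof -
  have "Max ((\<lambda>p. fst p + snd p) ` F) \<in> (\<lambda>p. fst p + snd p) ` F" using assms by simp
  then obtain i j where ij: "(i, j) \<in> F" "i + j = Max ((\<lambda>p. fst p + snd p) ` F)" by auto
  have le: "fst p + snd p \<le> i + j" if "p \<in> F" for p
    unfolding ij(2) using assms(1) that by simp
  have "(i, j) \<in> corners F"
    using ij(1) le[of "(i + 1, j)"] le[of "(i, j + 1)"] by (auto simp: corners_def)
  then show ?thesis by blast
qed

lemma Out_empty_iff:
  assumes "finite (inner_diagram m P)"
  shows "Out m (inflate m U P) = {} \<longleftrightarrow> inner_diagram m P = {}"
proof -
  let ?F = "inner_diagram m P"
  have empty: "corners X = {} \<longleftrightarrow> X = {}" if "X \<subseteq> ?F" for X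
    using finite_nonempty_has_corner[OF finite_subset[OF that assms]] by (auto simp: corners_def)
  have "Out m (inflate m U P) = corners (upper_part m ?F) \<union> corners (lower_part m ?F)"
    by (simp add: Out_def inflate_def)
  moreover have "corners (upper_part m ?F) = {} \<longleftrightarrow> upper_part m ?F = {}"
    and "corners (lower_part m ?F) = {} \<longleftrightarrow> lower_part m ?F = {}"
    by (rule empty; auto simp: upper_part_def lower_part_def)+
  moreover have "?F = {} \<longleftrightarrow> upper_part m ?F = {} \<and> lower_part m ?F = {}"
    by (auto simp: upper_part_def lower_part_def not_le)
  ultimately show ?thesis by simp
qed

lemma ex_greatest_nat:
  fixes f :: "'a \<Rightarrow> nat"
  assumes "finite A" and "A \<noteq> {}"
  shows "\<exists>d\<in>A. \<forall>c\<in>A. f c \<le> f d"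
proof -
  have "Max (f ` A) \<in> f ` A" using assms by simp
  then show ?thesis using assms(1) by (metis (no_types, lifting) Max_ge finite_imageI imageE image_eqI)
qed

text \<open>
  There is at most one upper corner per column and one lower corner per row, so the preorder on boxes
  is antisymmetric on outer corners and the greatest one is well defined. It is an upper corner only
  when no lower ones are left.
\<close>

lemma greatest_corner_props:
  assumes P: "is_trivial_pair m n P" and fin: "finite (inner_diagram m P)"
    and ne: "Out m (inflate m U P) \<noteq> {}"
  defines "d \<equiv> greatest_corner m (inflate m U P)"
  shows "d \<in> Out m (inflate m U P)"
    and "fst d \<le> m \<Longrightarrow> lower_part m (inner_diagram m P) = {}"
proof -
  define L where "L = corners (lower_part m (inner_diagram m P))"
  define V where "V = corners (upper_part m (inner_diagram m P))"
  have Out: "Out m (inflate m U P) = V \<union> L" by (auto simp: Out_def inflate_def L_def V_def)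
  have low: "m < fst c" if "c \<in> L" for c
    using that by (auto simp: L_def corners_def lower_part_def)
  have upp: "fst c \<le> m" if "c \<in> V" for c
    using that by (auto simp: V_def corners_def upper_part_def)
  have finV: "finite V" and finL: "finite L"
    by (rule finite_subset[OF _ fin]; auto simp: V_def L_def corners_def upper_part_def lower_part_def)+
  have injL: "c = e" if "c \<in> L" "e \<in> L" "fst c = fst e" for c e
  proof -
    have step: "snd P b \<le> snd P (Suc a)" if "1 \<le> a" "a < b" for a b
      using Suc_leI[OF that(2)]
    proof (induction rule: dec_induct)
      case (step k)
      have "snd P (Suc k) \<le> snd P k"
        using P that(1) step(1) by (simp add: is_trivial_pair_iff)
      then show ?case using step(3) by (rule le_trans)
    qed simp
    have False if "(i, a) \<in> L" "(i, b) \<in> L" "a < b" for i a b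
      using lower_cornerD[OF that(1)[unfolded L_def]] lower_cornerD[OF that(2)[unfolded L_def]]
        step[of a b] that(3) by simp
    then show ?thesis using that by (metis linorder_neqE_nat prod.collapse)
  qed
  have injV: "c = e" if "c \<in> V" "e \<in> V" "snd c = snd e" for c e
  proof -
    have step: "fst P b \<le> fst P (Suc a)" if "1 \<le> a" "a < b" for a b
      using Suc_leI[OF that(2)]
    proof (induction rule: dec_induct)
      case (step k)
      have "fst P (Suc k) \<le> fst P k"
        using P that(1) step(1) by (simp add: is_trivial_pair_iff)
      then show ?case using step(3) by (rule le_trans)
    qed simp
    have False if "(a, j) \<in> V" "(b, j) \<in> V" "a < b" for j a b
      using upper_cornerD[OF P that(1)[unfolded V_def]] upper_cornerD[OF P that(2)[unfolded V_def]]
        step[of a b] that(3) by simp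
    then show ?thesis using that by (metis linorder_neqE_nat prod.collapse)
  qed
  have unique: "d = g" if "g \<in> V \<union> L" "\<And>c. c \<in> V \<union> L \<Longrightarrow> corner_le m c g" for g
    unfolding d_def greatest_corner_def Out
  proof (rule the_equality)
    show "g \<in> V \<union> L \<and> (\<forall>c\<in>V \<union> L. corner_le m c g)" using that by blast
    fix e assume e: "e \<in> V \<union> L \<and> (\<forall>c\<in>V \<union> L. corner_le m c e)"
    then have le: "corner_le m e g" "corner_le m g e" using that by auto
    show "e = g"
    proof (cases "fst g \<le> m")
      case True
      then have "fst e \<le> m" "snd e = snd g" using le by (auto simp: corner_le_def split: if_splits)
      moreover from this True have "e \<in> V" "g \<in> V" using e that(1) low[of e] low[of g] by auto
      ultimately show ?thesis using injV by blast
    next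
      case False
      then have "m < fst e" "fst e = fst g" using le by (auto simp: corner_le_def split: if_splits)
      moreover from this False have "e \<in> L" "g \<in> L" using e that(1) upp[of e] upp[of g] by auto
      ultimately show ?thesis using injL by blast
    qed
  qed
  have "d \<in> V \<union> L \<and> (fst d \<le> m \<longrightarrow> L = {})"
  proof (cases "L = {}")
    case True
    then obtain g where "g \<in> V" "\<forall>c\<in>V. snd c \<le> snd g"
      using ex_greatest_nat[OF finV, of snd] ne Out by auto
    then show ?thesis using unique[of g] True upp by (auto simp: corner_le_def)
  next
    case False
    then obtain g where g: "g \<in> L" "\<forall>c\<in>L. fst c \<le> fst g"
      using ex_greatest_nat[OF finL, of fst] by auto
    have "corner_le m c g" if "c \<in> V \<union> L" for c
      using that g low[of g] low[of c] upp[of c] by (auto simp: corner_le_def)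
    then have "d = g" using unique[of g] g(1) by blast
    then show ?thesis using g low[of g] by auto
  qed
  then show "d \<in> Out m (inflate m U P)" "fst d \<le> m \<Longrightarrow> lower_part m (inner_diagram m P) = {}"
    using Out finite_nonempty_has_corner[of "lower_part m (inner_diagram m P)"] fin
    by (auto simp: L_def lower_part_def)
qed

lemma sjdt_greatest_corner:
  assumes "young_diagram (dom U)" and "semistandard_filling m U" and "0 \<notin> ran U"
    and P: "is_trivial_pair m n P" and fin: "finite (inner_diagram m P)"
    and ne: "Out m (inflate m U P) \<noteq> {}"
  defines "d \<equiv> greatest_corner m (inflate m U P)"
  shows "sjdt m d (inflate m U P) = inflate m U (shrink m P d)"
    and "is_trivial_pair m n (shrink m P d)"
    and "inner_diagram m (shrink m P d) = inner_diagram m P - {d}"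
    and "d \<in> inner_diagram m P"
proof -
  have d: "d \<in> Out m (inflate m U P)"
    and low: "fst d \<le> m \<Longrightarrow> lower_part m (inner_diagram m P) = {}"
    unfolding d_def using greatest_corner_props[OF P fin ne] by blast+
  show "d \<in> inner_diagram m P"
    using d by (auto simp: Out_def inflate_def corners_def upper_part_def lower_part_def)
  consider (upper) "d \<in> corners (upper_part m (inner_diagram m P))"
    | (lower) "d \<in> corners (lower_part m (inner_diagram m P))"
    using d by (auto simp: Out_def inflate_def)
  then have "sjdt m d (inflate m U P) = inflate m U (shrink m P d) \<and>
    is_trivial_pair m n (shrink m P d) \<and>
    inner_diagram m (shrink m P d) = inner_diagram m P - {d}"
  proof cases
    case upper
    then have "fst d \<le> m" by (auto simp: corners_def upper_part_def)
    have "snd P j = 0" for j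
    proof (rule ccontr)
      assume nz: "snd P j \<noteq> 0"
      then have "1 \<le> j" using P by (cases "j = 0") (auto simp: is_trivial_pair_iff)
      then have "(m + 1, j) \<in> lower_part m (inner_diagram m P)"
        using nz by (simp add: inner_diagram_def lower_part_def)
      then show False using low[OF \<open>fst d \<le> m\<close>] by simp
    qed
    then show ?thesis
      using sjdt_upper_corner[OF assms(1,2) P upper] shrink_upper_corner[OF P upper] by blast
  next
    case lower
    then show ?thesis
      using sjdt_lower_corner[OF assms(1-3) P lower] shrink_lower_corner[OF P lower] by blast
  qed
  then show "sjdt m d (inflate m U P) = inflate m U (shrink m P d)"
    "is_trivial_pair m n (shrink m P d)"
    "inner_diagram m (shrink m P d) = inner_diagram m P - {d}" by blast+
qed

text \<open>
  Each slide removes one box from the inner diagram, and the sequence after the first step has the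
  same form, with a smaller pair and the same \<open>U\<close>.
\<close>

lemma sjdt_sequence_end:
  assumes U: "young_diagram (dom U)" "semistandard_filling m U" "0 \<notin> ran U"
    and "is_trivial_pair m n P" and "finite (inner_diagram m P)"
    and "R 0 = inflate m U P"
    and "\<And>r. Out m (R r) \<noteq> {} \<Longrightarrow> R (Suc r) = sjdt m (greatest_corner m (R r)) (R r)"
  shows "Out m (R (LEAST r. Out m (R r) = {})) = {} \<and> R (LEAST r. Out m (R r) = {}) = skew_of U"
  using assms(4-)
proof (induction "card (inner_diagram m P)" arbitrary: P R rule: less_induct)
  case less
  show ?case
  proof (cases "Out m (R 0) = {}")
    case True
    then have "(LEAST r. Out m (R r) = {}) = 0" by simp
    moreover have "inner_diagram m P = {}"
      using True Out_empty_iff[OF less.prems(2)] less.prems(3) by simp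
    ultimately show ?thesis
      using True inflate_empty_inner[OF less.prems(1) U(1)] less.prems(3) by simp
  next
    case False
    define d where "d = greatest_corner m (inflate m U P)"
    note slide = sjdt_greatest_corner[OF U less.prems(1,2) False[unfolded less.prems(3)],
        folded d_def]
    have IH: "Out m (R (Suc (LEAST r. Out m (R (Suc r)) = {}))) = {} \<and>
        R (Suc (LEAST r. Out m (R (Suc r)) = {})) = skew_of U"
    proof (rule less.hyps[where P = "shrink m P d" and R = "\<lambda>r. R (Suc r)"])
      show "card (inner_diagram m (shrink m P d)) < card (inner_diagram m P)"
        unfolding slide(3) using slide(4) less.prems(2) by (rule card_Diff1_less[rotated])
      show "R (Suc 0) = inflate m U (shrink m P d)"
        using less.prems(4)[OF False] slide(1) by (simp add: less.prems(3) d_def)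
    qed (use slide less.prems in auto)
    then have Suc: "(LEAST r. Out m (R r) = {}) = Suc (LEAST r. Out m (R (Suc r)) = {})"
      using False by (intro Least_Suc) auto
    show ?thesis unfolding Suc by (rule IH)
  qed
qed

section \<open>The maximal extractable pair\<close>

lemma upper_trivial_dom_end:
  assumes "is_trivial_pair m n P" and "fst P i \<noteq> 0"
  shows "(i, fst P i) \<in> dom (upper_trivial m P)"
proof -
  have "i \<noteq> 0" "i \<le> m" 
    using assms unfolding is_trivial_pair_iff by (metis, metis linorder_not_le)
  then show ?thesis using assms(2) by (simp add: domIff upper_trivial_def)
qed

lemma lower_trivial_dom_end:
  assumes "is_trivial_pair m n P" and "snd P j \<noteq> 0"
  shows "(m + snd P j, j) \<in> dom (lower_trivial m n P)"
proof -
  have "j \<noteq> 0" "j \<le> n - 1"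
    using assms unfolding is_trivial_pair_iff by (metis, metis linorder_not_le)
  then show ?thesis using assms(2) by (simp add: domIff lower_trivial_def)
qed

lemma upper_trivial_le_imp:
  assumes "is_trivial_pair m n P" and "upper_trivial m P \<subseteq>\<^sub>m upper_trivial m Q"
  shows "fst P i \<le> fst Q i"
proof (cases "fst P i = 0")
  case False
  then have "(i, fst P i) \<in> dom (upper_trivial m Q)"
    using upper_trivial_dom_end[OF assms(1)] map_le_implies_dom_le[OF assms(2)] by blast
  then show ?thesis by (auto simp: upper_trivial_def split: if_splits)
qed simp

lemma lower_trivial_le_imp:
  assumes "is_trivial_pair m n P" and "lower_trivial m n P \<subseteq>\<^sub>m lower_trivial m n Q"
  shows "snd P j \<le> snd Q j"
proof (cases "snd P j = 0")
  case False
  then have "(m + snd P j, j) \<in> dom (lower_trivial m n Q)"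
    using lower_trivial_dom_end[OF assms(1)] map_le_implies_dom_le[OF assms(2)] by blast
  then show ?thesis by (auto simp: lower_trivial_def split: if_splits)
qed simp

lemma maximal_extractable_unique:
  assumes "maximal_extractable m n T P" and "maximal_extractable m n T Q"
  shows "P = Q"
proof (rule prod_eqI)
  have t: "is_trivial_pair m n P" "is_trivial_pair m n Q"
    and le: "upper_trivial m P \<subseteq>\<^sub>m upper_trivial m Q" "upper_trivial m Q \<subseteq>\<^sub>m upper_trivial m P"
      "lower_trivial m n P \<subseteq>\<^sub>m lower_trivial m n Q" "lower_trivial m n Q \<subseteq>\<^sub>m lower_trivial m n P"
    using assms unfolding maximal_extractable_def extractable_def by blast+
  show "fst P = fst Q"
    using upper_trivial_le_imp[OF t(1) le(1)] upper_trivial_le_imp[OF t(2) le(2)]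
    by (intro ext le_antisym)
  show "snd P = snd Q"
    using lower_trivial_le_imp[OF t(1) le(3)] lower_trivial_le_imp[OF t(2) le(4)]
    by (intro ext le_antisym)
qed

text \<open>
  Let \<open>p\<close> be the left or upper neighbour of \<open>q\<close>. Choose a pair \<open>P\<close> of the family that attains the
  supremum in the row or column of \<open>p\<close>. Then the extractions by \<open>P\<close> and by \<open>D\<close> agree at \<open>p\<close>, while at
  \<open>q\<close> the one by \<open>P\<close> has an entry that is no larger, being
  shifted by no more. So whatever \<open>p\<close> and \<open>q\<close> have to
  satisfy is inherited from \<open>P\<close>.
\<close>

lemma extractable_sup:
  assumes m: "1 \<le> m" and n: "1 \<le> n" and T: "semistandard_tableau m n T"
    and E: "\<And>P. P \<in> E \<Longrightarrow> extractable m n T P"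
    and upper: "\<And>i. \<exists>P\<in>E. fst P i = fst D i" "\<And>P i. P \<in> E \<Longrightarrow> fst P i \<le> fst D i"
    and lower: "\<And>j. \<exists>P\<in>E. snd P j = snd D j" "\<And>P j. P \<in> E \<Longrightarrow> snd P j \<le> snd D j"
  shows "extractable m n T D"
proof -
  have yT: "young_diagram (dom T)" and sT: "semistandard_filling m T" and rT: "ran T \<subseteq> {1..m + n}"
    using T tableau_iff[OF m n] unfolding semistandard_tableau_def by blast+
  have triv: "is_trivial_pair m n P" and upp: "upper_trivial m P \<subseteq>\<^sub>m T"
    and low: "lower_trivial m n P \<subseteq>\<^sub>m T" if "P \<in> E" for P
    using E[OF that] unfolding extractable_def by blast+
  have yP: "young_diagram (dom (extraction m T P))"
    and cP: "(m + 1, n) \<notin> dom (extraction m T P)"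
    and sP: "semistandard_filling m (extraction m T P)" if "P \<in> E" for P
    using E[OF that] tableau_iff[OF m n] unfolding extractable_def semistandard_tableau_def
    by blast+
  let ?V = "extraction m T D"
  have D: "is_trivial_pair m n D"
    unfolding is_trivial_pair_iff
  proof (intro conjI allI impI)
    show "fst D 0 = 0" using upper(1)[of 0] triv by (metis is_trivial_pair_iff)
    show "snd D 0 = 0" using lower(1)[of 0] triv by (metis is_trivial_pair_iff)
    show "fst D i = 0" if "m < i" for i using upper(1)[of i] triv that by (metis is_trivial_pair_iff)
    show "snd D j = 0" if "n - 1 < j" for j
      using lower(1)[of j] triv that by (metis is_trivial_pair_iff)
    show "fst D (Suc i) \<le> fst D i" if "1 \<le> i" for i
    proof -
      obtain P where P: "P \<in> E" "fst P (Suc i) = fst D (Suc i)" using upper(1) by blast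
      have "fst P (Suc i) \<le> fst P i" using triv[OF P(1)] that by (simp add: is_trivial_pair_iff)
      then show ?thesis using P(2) upper(2)[OF P(1), of i] by simp
    qed
    show "snd D (Suc j) \<le> snd D j" if "1 \<le> j" for j
    proof -
      obtain P where P: "P \<in> E" "snd P (Suc j) = snd D (Suc j)" using lower(1) by blast
      have "snd P (Suc j) \<le> snd P j" using triv[OF P(1)] that by (simp add: is_trivial_pair_iff)
      then show ?thesis using P(2) lower(2)[OF P(1), of j] by simp
    qed
  qed
  have "upper_trivial m D \<subseteq>\<^sub>m T"
    unfolding map_le_def
  proof
    fix p assume p: "p \<in> dom (upper_trivial m D)"
    obtain P where "P \<in> E" "fst P (fst p) = fst D (fst p)" using upper(1) by blast
    then show "upper_trivial m D p = T p"
      using p upp[of P] by (cases p) (force simp: map_le_def upper_trivial_def dom_def split: if_splits)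
  qed
  moreover have "lower_trivial m n D \<subseteq>\<^sub>m T"
    unfolding map_le_def
  proof
    fix p assume p: "p \<in> dom (lower_trivial m n D)"
    obtain P where "P \<in> E" "snd P (snd p) = snd D (snd p)" using lower(1) by blast
    then show "lower_trivial m n D p = T p"
      using p low[of P] by (cases p) (force simp: map_le_def lower_trivial_def dom_def split: if_splits)
  qed
  moreover have "semistandard_tableau m n ?V"
  proof -
    have decrease: "\<exists>y'. extraction m T P q = Some y' \<and> y' \<le> y" if "P \<in> E" "?V q = Some y" for P q y
    proof -
      obtain i j where q: "q = (i, j)" by (cases q)
      have "fst P i \<le> fst D i" "snd P j \<le> snd D j" using upper(2) lower(2) that(1) by auto
      then show ?thesis
        using that(2) entry_mono[OF yT sT, of i "j + fst D i" y i "j + fst P i"]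
          entry_mono[OF yT sT, of "i + snd D j" j y "i + snd P j" j]
        unfolding q by (auto simp: extraction_def split: if_splits)
    qed
    have compare: "\<exists>P\<in>E. \<exists>y'\<le>y. extraction m T P q = Some y' \<and> extraction m T P p = ?V p"
      if "?V q = Some y" for p q y
    proof -
      obtain i j where p: "p = (i, j)" by (cases p)
      have "\<exists>P\<in>E. extraction m T P p = ?V p"
      proof (cases "i \<le> m")
        case True
        obtain P where "P \<in> E" "fst P i = fst D i" using upper(1) by blast
        then show ?thesis using True by (intro bexI[of _ P]) (auto simp: p extraction_def)
      next
        case False
        obtain P where "P \<in> E" "snd P j = snd D j" using lower(1) by blast
        then show ?thesis using False by (intro bexI[of _ P]) (auto simp: p extraction_def)
      qed
      then show ?thesis using decrease that by blast
    qed
    obtain P0 where P0: "P0 \<in> E" using upper(1) by blast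
    have sub: "dom ?V \<subseteq> dom (extraction m T P0)" using decrease[OF P0] by blast
    have "young_diagram (dom ?V)"
      unfolding young_diagram_def
    proof (intro conjI allI impI)
      show "finite (dom ?V)" using sub yP[OF P0] finite_subset unfolding young_diagram_def by blast
      show "1 \<le> i" "1 \<le> j" if "(i, j) \<in> dom ?V" for i j
        using that by (auto simp: extraction_def split: if_splits)
      show "(i, j) \<in> dom ?V" if q: "(Suc i, j) \<in> dom ?V \<and> 1 \<le> i" for i j
      proof -
        obtain P where "P \<in> E" "(Suc i, j) \<in> dom (extraction m T P)"
          and "extraction m T P (i, j) = ?V (i, j)"
          using compare[of "(Suc i, j)" _ "(i, j)"] q by blast
        then show ?thesis using yP[of P] q unfolding young_diagram_def by (metis domIff)
      qed
      show "(i, j) \<in> dom ?V" if q: "(i, Suc j) \<in> dom ?V \<and> 1 \<le> j" for i j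
      proof -
        obtain P where "P \<in> E" "(i, Suc j) \<in> dom (extraction m T P)"
          and "extraction m T P (i, j) = ?V (i, j)"
          using compare[of "(i, Suc j)" _ "(i, j)"] q by blast
        then show ?thesis using yP[of P] q unfolding young_diagram_def by (metis domIff)
      qed
    qed
    moreover have "(m + 1, n) \<notin> dom ?V" using sub cP[OF P0] by blast
    moreover have "ran ?V \<subseteq> {1..m + n}"
    proof
      fix x assume "x \<in> ran ?V"
      then have "x \<in> ran T" by (auto simp: ran_def extraction_def split: if_splits)
      then show "x \<in> {1..m + n}" using rT by blast
    qed
    moreover have "semistandard_filling m ?V"
      unfolding semistandard_filling_def
    proof (intro conjI allI impI; elim conjE)
      fix i j x y
      assume p: "?V (i, j) = Some x" and q: "?V (i, j + 1) = Some y"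
      obtain P y' where "P \<in> E" "y' \<le> y" "extraction m T P (i, j + 1) = Some y'"
        "extraction m T P (i, j) = Some x"
        using compare[OF q, of "(i, j)"] p by auto
      then have "y' \<le> y \<and> x \<le> y' \<and> (x > m \<longrightarrow> x < y')"
        using sP[of P] unfolding semistandard_filling_def by blast
      then show "x \<le> y" "x > m \<Longrightarrow> x < y" by auto
    next
      fix i j x y
      assume p: "?V (i, j) = Some x" and q: "?V (i + 1, j) = Some y"
      obtain P y' where "P \<in> E" "y' \<le> y" "extraction m T P (i + 1, j) = Some y'"
        "extraction m T P (i, j) = Some x"
        using compare[OF q, of "(i, j)"] p by auto
      then have "y' \<le> y \<and> x \<le> y' \<and> (x \<le> m \<longrightarrow> x < y')"
        using sP[of P] unfolding semistandard_filling_def by blast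
      then show "x \<le> y" "x \<le> m \<Longrightarrow> x < y" by auto
    qed
    ultimately show ?thesis unfolding semistandard_tableau_def tableau_iff[OF m n] by blast
  qed
  ultimately show ?thesis using D unfolding extractable_def by blast
qed

lemma ex_maximal_extractable:
  assumes m: "1 \<le> m" and n: "1 \<le> n" and T: "semistandard_tableau m n T"
    and S: "extractable m n T S"
  shows "\<exists>D. maximal_extractable m n T D"
proof -
  define E where "E = {P. extractable m n T P}"
  have fin: "finite (dom T)"
    using T tableau_iff[OF m n] unfolding semistandard_tableau_def young_diagram_def by blast
  have fin_upper: "finite ((\<lambda>P. fst P i) ` E)" for i
  proof (rule finite_subset)
    show "(\<lambda>P. fst P i) ` E \<subseteq> insert 0 (snd ` dom T)"
    proof (rule image_subsetI)
      fix P assume "P \<in> E"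
      then have t: "is_trivial_pair m n P" and le: "upper_trivial m P \<subseteq>\<^sub>m T"
        by (auto simp: E_def extractable_def)
      show "fst P i \<in> insert 0 (snd ` dom T)"
      proof (cases "fst P i = 0")
        case False
        then have "(i, fst P i) \<in> dom (upper_trivial m P)"
          by (simp add: upper_trivial_dom_end[OF t])
        then have "(i, fst P i) \<in> dom T" using map_le_implies_dom_le[OF le] by blast
        then show ?thesis by force
      qed simp
    qed
  qed (use fin in simp)
  have fin_lower: "finite ((\<lambda>P. snd P j) ` E)" for j
  proof (rule finite_subset)
    show "(\<lambda>P. snd P j) ` E \<subseteq> insert 0 ((\<lambda>p. fst p - m) ` dom T)"
    proof (rule image_subsetI)
      fix P assume "P \<in> E"
      then have t: "is_trivial_pair m n P" and le: "lower_trivial m n P \<subseteq>\<^sub>m T"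
        by (auto simp: E_def extractable_def)
      show "snd P j \<in> insert 0 ((\<lambda>p. fst p - m) ` dom T)"
      proof (cases "snd P j = 0")
        case False
        then have "(m + snd P j, j) \<in> dom (lower_trivial m n P)"
          by (simp add: lower_trivial_dom_end[OF t])
        then have "(m + snd P j, j) \<in> dom T" using map_le_implies_dom_le[OF le] by blast
        then show ?thesis by force
      qed simp
    qed
  qed (use fin in simp)
  have ne: "E \<noteq> {}" using S unfolding E_def by blast
  define D where "D = (\<lambda>i. Max ((\<lambda>P. fst P i) ` E), \<lambda>j. Max ((\<lambda>P. snd P j) ` E))"
  have upper: "\<exists>P\<in>E. fst P i = fst D i" for i
  proof -
    have "fst D i \<in> (\<lambda>P. fst P i) ` E"
      using Max_in[OF fin_upper[of i]] ne by (simp add: D_def)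
    then show ?thesis by (elim imageE) metis
  qed
  have lower: "\<exists>P\<in>E. snd P j = snd D j" for j
  proof -
    have "snd D j \<in> (\<lambda>P. snd P j) ` E"
      using Max_in[OF fin_lower[of j]] ne by (simp add: D_def)
    then show ?thesis by (elim imageE) metis
  qed
  have upper_le: "fst P i \<le> fst D i" if "P \<in> E" for P i
    using Max_ge[OF fin_upper[of i]] that by (auto simp: D_def)
  have lower_le: "snd P j \<le> snd D j" if "P \<in> E" for P j
    using Max_ge[OF fin_lower[of j]] that by (auto simp: D_def)
  have "extractable m n T D"
    by (rule extractable_sup[OF m n T, of E]) (use upper lower upper_le lower_le in \<open>auto simp: E_def\<close>)
  moreover have "upper_trivial m P \<subseteq>\<^sub>m upper_trivial m D \<and> lower_trivial m n P \<subseteq>\<^sub>m lower_trivial m n D"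
    if "extractable m n T P" for P
    using upper_le[of P] lower_le[of P] that
    by (fastforce simp: E_def map_le_def upper_trivial_def lower_trivial_def dom_def
        split: if_splits intro: le_trans)
  ultimately show ?thesis unfolding maximal_extractable_def by blast
qed

section \<open>Pushing is the maximal super jeu de taquin\<close>

lemma sjdt_sequence_extraction:
  assumes "1 \<le> m" and "1 \<le> n" and T: "semistandard_tableau m n T" and S: "extractable m n T S"
    and "R 0 = remove_pair m n T S"
    and "\<And>r. Out m (R r) \<noteq> {} \<Longrightarrow> R (Suc r) = sjdt m (greatest_corner m (R r)) (R r)"
  shows "Out m (R (LEAST r. Out m (R r) = {})) = {} \<and>
    R (LEAST r. Out m (R r) = {}) = skew_of (extraction m T S)"
proof (rule sjdt_sequence_end[where P = S])
  have yT: "young_diagram (dom T)"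
    using T tableau_iff[OF assms(1,2)] unfolding semistandard_tableau_def by blast
  have U: "semistandard_tableau m n (extraction m T S)" using S by (simp add: extractable_def)
  show "young_diagram (dom (extraction m T S))" "semistandard_filling m (extraction m T S)"
    "0 \<notin> ran (extraction m T S)"
    using U tableau_iff[OF assms(1,2)] unfolding semistandard_tableau_def by auto
  show t: "is_trivial_pair m n S" using S by (simp add: extractable_def)
  have "inner_diagram m S \<subseteq> dom T"
    using S map_le_implies_dom_le unfolding inner_diagram_eq[OF t] extractable_def by blast
  then show "finite (inner_diagram m S)"
    using yT finite_subset unfolding young_diagram_def by blast
  show "R 0 = inflate m (extraction m T S) S"
    using assms(5) remove_pair_eq_inflate[OF t yT] by simp
qed (use assms(6) in blast)

theorem proposition10p2:
  fixes m n k :: nat and T :: filling and S :: trivial_pair and R :: "nat \<Rightarrow> skew"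
  assumes "m \<ge> 1" and "n \<ge> 1"
    and "semistandard_tableau m n T"
    and "extractable m n T S"
    and "R 0 = remove_pair m n T S"
    and "\<And>r. Out m (R r) \<noteq> {} \<Longrightarrow> R (Suc r) = sjdt m (greatest_corner m (R r)) (R r)"
    and "k = (LEAST r. Out m (R r) = {})"
  shows "Out m (R k) = {}
    \<and> (\<exists>U. semistandard_tableau m n U \<and> R k = skew_of U)
    \<and> (maximal_extractable m n T S \<longrightarrow> R k = skew_of (push m n T))
    \<and> maxjdt m (remove_pair m n T (maximal_pair m n T)) = skew_of (push m n T)"
proof (intro conjI impI)
  have Rk: "Out m (R k) = {} \<and> R k = skew_of (extraction m T S)"
    unfolding assms(7) by (rule sjdt_sequence_extraction[OF assms(1-6)])
  then show "Out m (R k) = {}" by blast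
  show "\<exists>U. semistandard_tableau m n U \<and> R k = skew_of U"
    using Rk assms(4) by (auto simp: extractable_def)
  obtain D where D: "maximal_extractable m n T D"
    using ex_maximal_extractable[OF assms(1-4)] by blast
  have max: "maximal_pair m n T = D"
    unfolding maximal_pair_def using D maximal_extractable_unique by blast
  show "R k = skew_of (push m n T)" if "maximal_extractable m n T S"
    using Rk maximal_extractable_unique[OF that D] by (simp add: push_def max)
  have "extractable m n T D" using D by (simp add: maximal_extractable_def)
  from sjdt_sequence_extraction[OF assms(1-3) this, of "sjdt_seq m (remove_pair m n T D)"]
  show "maxjdt m (remove_pair m n T (maximal_pair m n T)) = skew_of (push m n T)"
    by (simp add: maxjdt_def push_def max)
qed

end
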